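(* Let $s,w:(0,\infty)\to(0,\infty)$ be nondecreasing, with $s$ locally integrable on $[0,\infty)$, and let $K:(0,\infty)\times(0,\infty)\to\mathbb{C}$ be continuous with $$|K(x,y)|\lesssim \min\{1,(s(x)w(y))^{-1/2}\},\qquad x,y>0.$$ For $f$ as described in the context put $Ff(y)=\int_0^\infty s(x)f(x)K(x,y)\,dx$, $y>0$. Let $1<p\le q<\infty$, $1\le a\le\infty$, and let $u,v$ be nonnegative measurable functions on $(0,\infty)$. Assume there exists $C>0$ such that $$\sup_{r>0}\bigg(\int_0^{1/r}u(y)w(y)^{q/a'}\,dy\bigg)^{1/q}\bigg(\int_0^r v(x)^{1-p'}s(x)^{p'/a'}\,dx\bigg)^{1/p'}\le C,$$ $$\sup_{r>0}\bigg(\int_{1/r}^\infty u(y)w(y)^{q(1/a'-1/2)}\,dy\bigg)^{1/q}\bigg(\int_r^\infty v(x)^{1-p'}s(x)^{p'(1/a'-1/2)}\,dx\bigg)^{1/p'}\le C.$$ Then the inequality $$\Vert w^{1/a'}Ff\Vert_{q,u}\lesssim\Vert s^{1/a}f\Vert_{p,v}$$ holds for every such measurable $f$, with a constant independent of $f$.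
   Context: Notation: for $0<p<\infty$ and a nonnegative measurable function $v$ on $(0,\infty)$, $\Vert f\Vert_{p,v}=\big(\int_0^\infty v(x)|f(x)|^p\,dx\big)^{1/p}$ (possibly $+\infty$). For $1\le a\le\infty$, $a'=a/(a-1)$ is the dual exponent ($1/a+1/a'=1$, with $1'=\infty$, $\infty'=1$, $1/\infty=0$). $A\lesssim B$ means $A\le cB$ with a constant $c>0$ independent of the essential variables ($x,y,f$). Conventions: $0\cdot\infty=0$, and $v^{1-p'}=\infty$ where $v=0$. Functions $f$: $f:(0,\infty)\to\mathbb{C}$ is measurable and satisfies $\int_0^1 s(x)|f(x)|\,dx+\int_1^\infty s(x)^{1/2}|f(x)|\,dx<\infty$, so that $Ff(y)$ is well defined for every $y>0$. *)

theory Defs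
  imports "HOL-Analysis.Analysis"
begin

text \<open>Real powers of extended nonnegative numbers: negative powers of \<open>0\<close> are \<open>\<infinity>\<close>, negative
  powers of \<open>\<infinity>\<close> are \<open>0\<close>. Unlike for \<open>powr\<close> on the reals, the zeroth power is always \<open>1\<close>.\<close>

definition epowr :: "ennreal \<Rightarrow> real \<Rightarrow> ennreal" where
  "epowr x r =
     (if r = 0 then 1
      else if x = 0 then (if r < 0 then \<infinity> else 0)
      else if x = \<infinity> then (if r < 0 then 0 else \<infinity>)
      else ennreal (enn2real x powr r))"

text \<open>The general formula would give \<open>\<infinity> / \<infinity> = 0\<close> at \<open>a = \<infinity>\<close>; at \<open>a = 1\<close> it gives
  \<open>1 / 0 = \<infinity>\<close> in \<^typ>\<open>ennreal\<close>.\<close>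

definition dual_exponent :: "ennreal \<Rightarrow> ennreal" where
  "dual_exponent a = (if a = \<infinity> then 1 else a / (a - 1))"

text \<open>The real number \<open>1/a\<close>, with \<open>1/\<infinity> = 0\<close>; intended for \<open>a \<ge> 1\<close>.\<close>

definition recip_exponent :: "ennreal \<Rightarrow> real" where
  "recip_exponent a = enn2real (1 / a)"

definition weighted_norm :: "real \<Rightarrow> (real \<Rightarrow> real) \<Rightarrow> (real \<Rightarrow> complex) \<Rightarrow> ennreal" where
  "weighted_norm p v f =
     epowr (\<integral>\<^sup>+ x\<in>{0<..}. ennreal (v x * norm (f x) powr p) \<partial>lebesgue) (1 / p)"

text \<open>Functions are total on \<^typ>\<open>real\<close>, but only their values on \<open>(0,\<infinity>)\<close> matter.\<close>

definition admissible :: "(real \<Rightarrow> real) \<Rightarrow> (real \<Rightarrow> complex) \<Rightarrow> bool" where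
  "admissible s f \<longleftrightarrow>
     f \<in> borel_measurable (lebesgue_on {0<..}) \<and>
     (\<integral>\<^sup>+ x\<in>{0<..<1}. ennreal (s x * norm (f x)) \<partial>lebesgue)
       + (\<integral>\<^sup>+ x\<in>{1<..}. ennreal (s x powr (1/2) * norm (f x)) \<partial>lebesgue) < \<infinity>"

definition F_transform ::
  "(real \<Rightarrow> real) \<Rightarrow> (real \<Rightarrow> real \<Rightarrow> complex) \<Rightarrow> (real \<Rightarrow> complex) \<Rightarrow> real \<Rightarrow> complex" where
  "F_transform s K f y = (LINT x:{0<..}|lebesgue. complex_of_real (s x) * f x * K x y)"

end

theory Submission
  imports Defs
begin

text \<open>
  Split the transform at \<open>x = 1/y\<close>. The kernel bound gives, up to a constant,
  \<open>|F f y| \<le> G y + w(y)^(-1/2) H y\<close>, where \<open>G y\<close> is the integral of \<open>s |f|\<close> over \<open>(0, 1/y)\<close>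
  and \<open>H y\<close> is the integral of \<open>s^(1/2) |f|\<close> over \<open>(1/y, \<infinity>)\<close> (lemma \<open>F_transform_bound\<close>).
  Both are finite, because \<open>f\<close> is admissible and \<open>s\<close> is monotone. The two conditions on the
  weights are exactly the Muckenhoupt conditions for the two weighted Hardy inequalities that
  bound \<open>G\<close> and \<open>H\<close> by the right-hand side (lemmas \<open>hardy_initial\<close> and \<open>hardy_tail\<close>).

  A Hardy inequality of this kind concerns a chain of sets \<open>A y\<close> and the integrals \<open>\<phi> y\<close> of a
  nonnegative function \<open>g\<close> over \<open>A y\<close>. Cut the range of \<open>\<phi>\<close> at the powers of \<open>2\<close>. On each
  dyadic piece \<open>\<phi>\<close> is comparable to the integral of \<open>g\<close> over the shell between two
  consecutive sets, Hoelder's inequality and the Muckenhoupt condition control the contribution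
  of this shell (lemma \<open>muckenhoupt_local\<close>), and the contributions are summed with
  \<open>\<Sum> a_k^(q/p) \<le> (\<Sum> a_k)^(q/p)\<close>, which holds since \<open>p \<le> q\<close> (lemma \<open>hardy_chain\<close>). The cuts
  exist because an integral over an interval depends continuously on its end points
  (lemma \<open>level_split\<close>).
\<close>

section \<open>Powers of extended nonnegative numbers\<close>

lemma epowr_ennreal: "0 \<le> x \<Longrightarrow> 0 < r \<Longrightarrow> epowr (ennreal x) r = ennreal (x powr r)"
  by (auto simp: epowr_def)

lemma epowr_0 [simp]: "0 < r \<Longrightarrow> epowr 0 r = 0"
  by (simp add: epowr_def)

lemma epowr_top [simp]: "0 < r \<Longrightarrow> epowr top r = top"
  by (simp add: epowr_def)

lemma epowr_eq_0_iff: "0 < r \<Longrightarrow> epowr x r = 0 \<longleftrightarrow> x = 0"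
  by (cases x) (auto simp: epowr_ennreal epowr_def)

lemma epowr_mono: "0 \<le> r \<Longrightarrow> x \<le> y \<Longrightarrow> epowr x r \<le> epowr y r"
  by (cases x; cases y) (auto simp: epowr_def enn2real_mono powr_mono2 top_unique)

lemma epowr_mult: "0 < r \<Longrightarrow> epowr (x * y) r = epowr x r * epowr y r"
proof -
  assume r: "0 < r"
  have top: "epowr (top * z) r = top * epowr z r" for z
    using r by (cases "z = 0") (auto simp: epowr_eq_0_iff ennreal_top_mult)
  show ?thesis
    using r top[of x] top[of y]
    by (cases x; cases y) (auto simp: epowr_ennreal powr_mult mult.commute simp flip: ennreal_mult)
qed

lemma epowr_epowr: "0 < r \<Longrightarrow> 0 < t \<Longrightarrow> epowr (epowr x r) t = epowr x (r * t)"
  by (cases x) (auto simp: epowr_ennreal powr_powr)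

lemma epowr_one [simp]: "epowr x 1 = x"
  by (cases x) (auto simp: epowr_def simp flip: infinity_ennreal_def)

lemma epowr_add: "0 \<le> r \<Longrightarrow> 0 \<le> t \<Longrightarrow> epowr x (r + t) = epowr x r * epowr x t"
  by (cases x) (auto simp: epowr_def powr_add ennreal_mult enn2real_eq_0_iff ennreal_top_mult)

text \<open>This is \<open>\<ell>\<^sup>1 \<subseteq> \<ell>\<^sup>t\<close> with norm one: each term is at most the sum \<open>S\<close>, so its
  \<open>t\<close>-th power is at most \<open>S\<close> to the power \<open>t - 1\<close> times the term itself. It is
  applied with \<open>t = q / p\<close>, which is at least \<open>1\<close> because \<open>p \<le> q\<close>.\<close>
lemma suminf_epowr_le:
  fixes a :: "nat \<Rightarrow> ennreal"
  assumes "1 \<le> t"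
  shows "(\<Sum>n. epowr (a n) t) \<le> epowr (\<Sum>n. a n) t"
proof -
  let ?S = "\<Sum>n. a n"
  have "a n \<le> ?S" for n
    using sum_le_suminf[of a "{n}"] by (simp add: summableI)
  then have "epowr (a n) t \<le> epowr ?S (t - 1) * a n" for n
    using epowr_add[of "t - 1" 1 "a n"] epowr_mono[of "t - 1" "a n" ?S] assms
    by (simp add: mult_right_mono)
  then have "(\<Sum>n. epowr (a n) t) \<le> (\<Sum>n. epowr ?S (t - 1) * a n)"
    by (intro suminf_le summableI) auto
  also have "\<dots> = epowr ?S t"
    using epowr_add[of "t - 1" 1 ?S] assms by simp
  finally show ?thesis .
qed

section \<open>Integral inequalities on chains of sets\<close>

lemma Holder_nn_integral:
  fixes f h :: "'a \<Rightarrow> real"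
  assumes [measurable]: "f \<in> borel_measurable M" "h \<in> borel_measurable M"
    and nonneg: "\<And>x. x \<in> space M \<Longrightarrow> 0 \<le> f x" "\<And>x. x \<in> space M \<Longrightarrow> 0 \<le> h x"
    and t: "0 < t" "t < 1"
  shows "(\<integral>\<^sup>+x. ennreal (f x powr t * h x powr (1 - t)) \<partial>M)
    \<le> epowr (\<integral>\<^sup>+x. ennreal (f x) \<partial>M) t * epowr (\<integral>\<^sup>+x. ennreal (h x) \<partial>M) (1 - t)"
proof -
  let ?X = "\<integral>\<^sup>+x. ennreal (f x) \<partial>M" and ?Y = "\<integral>\<^sup>+x. ennreal (h x) \<partial>M"
  consider "?X = 0 \<or> ?Y = 0" | "?X \<noteq> 0" "?Y \<noteq> 0" "?X = \<infinity> \<or> ?Y = \<infinity>"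
    | "?X \<noteq> 0" "?Y \<noteq> 0" "?X \<noteq> \<infinity>" "?Y \<noteq> \<infinity>" by blast
  then show ?thesis
  proof cases
    case 1
    then have "(AE x in M. f x = 0) \<or> (AE x in M. h x = 0)"
    proof (elim disjE)
      assume "?X = 0"
      then have "AE x in M. f x \<le> 0" by (simp add: nn_integral_0_iff_AE ennreal_eq_0_iff)
      moreover have "AE x in M. 0 \<le> f x" using nonneg by (intro AE_I2)
      ultimately have "AE x in M. f x = 0" by eventually_elim simp
      then show ?thesis ..
    next
      assume "?Y = 0"
      then have "AE x in M. h x \<le> 0" by (simp add: nn_integral_0_iff_AE ennreal_eq_0_iff)
      moreover have "AE x in M. 0 \<le> h x" using nonneg by (intro AE_I2)
      ultimately have "AE x in M. h x = 0" by eventually_elim simp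
      then show ?thesis ..
    qed
    then have "AE x in M. ennreal (f x powr t * h x powr (1 - t)) = 0"
      by (auto elim!: AE_mp)
    then have "(\<integral>\<^sup>+x. ennreal (f x powr t * h x powr (1 - t)) \<partial>M) = 0"
      by (subst nn_integral_0_iff_AE) auto
    then show ?thesis by simp
  next
    case 2
    then have "epowr ?X t * epowr ?Y (1 - t) = \<infinity>"
      using t by (auto simp: epowr_eq_0_iff ennreal_mult_eq_top_iff)
    then show ?thesis by simp
  next
    case 3
    then obtain X Y where X: "?X = ennreal X" "0 < X" and Y: "?Y = ennreal Y" "0 < Y"
      by (metis ennreal_0 ennreal_cases infinity_ennreal_def less_eq_real_def)
    \<comment> \<open>Young's inequality for the functions normalised to have integral \<open>1\<close>.\<close>
    have young: "f x powr t * h x powr (1 - t)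
        \<le> X powr t * Y powr (1 - t) * (t / X * f x + (1 - t) / Y * h x)"
      if "x \<in> space M" for x
    proof (cases "f x = 0 \<or> h x = 0")
      case True
      then show ?thesis using nonneg[OF that] X Y t by auto
    next
      case False
      then have pos: "0 < f x" "0 < h x" using nonneg[OF that] by auto
      have "(f x / X) powr t * (h x / Y) powr (1 - t) \<le> t * (f x / X) + (1 - t) * (h x / Y)"
        using pos X Y t by (intro Youngs_inequality_0) auto
      then have "X powr t * Y powr (1 - t) * ((f x / X) powr t * (h x / Y) powr (1 - t))
          \<le> X powr t * Y powr (1 - t) * (t * (f x / X) + (1 - t) * (h x / Y))"
        by (intro mult_left_mono) auto
      then show ?thesis using pos X Y by (simp add: powr_divide)
    qed
    have "(\<integral>\<^sup>+x. ennreal (f x powr t * h x powr (1 - t)) \<partial>M)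
        \<le> (\<integral>\<^sup>+x. ennreal (X powr t * Y powr (1 - t)) *
              (ennreal (t / X) * ennreal (f x) + ennreal ((1 - t) / Y) * ennreal (h x)) \<partial>M)"
    proof (rule nn_integral_mono)
      fix x assume x: "x \<in> space M"
      show "ennreal (f x powr t * h x powr (1 - t)) \<le> ennreal (X powr t * Y powr (1 - t)) *
              (ennreal (t / X) * ennreal (f x) + ennreal ((1 - t) / Y) * ennreal (h x))"
        using young[OF x] nonneg[OF x] X Y t
        by (simp add: ennreal_leI flip: ennreal_mult ennreal_plus)
    qed
    also have "\<dots> = ennreal (X powr t * Y powr (1 - t)) *
        (ennreal (t / X) * ennreal X + ennreal ((1 - t) / Y) * ennreal Y)"
      using X Y by (simp add: nn_integral_cmult nn_integral_add)
    also have "\<dots> = epowr ?X t * epowr ?Y (1 - t)"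
      using X Y t by (simp add: epowr_ennreal flip: ennreal_mult ennreal_plus)
    finally show ?thesis .
  qed
qed

lemma dyadic_level:
  fixes x :: real
  assumes "0 < x"
  obtains k :: int where "2 powr real_of_int k < x" "x \<le> 2 powr (real_of_int k + 1)"
proof
  let ?k = "\<lceil>log 2 x\<rceil> - 1"
  have "real_of_int ?k < log 2 x" "log 2 x \<le> real_of_int ?k + 1" by linarith+
  then show "2 powr real_of_int ?k < x" "x \<le> 2 powr (real_of_int ?k + 1)"
    using assms by (simp_all only: less_log_iff log_le_iff)
qed

text \<open>The weighted Hardy inequality by dyadic discretisation. Choose points \<open>r k\<close> at which the
  increasing quantity \<open>\<phi>\<close> equals \<open>2^k\<close>, and let \<open>S k\<close> be the shell between
  \<open>A (r (k - 1))\<close> and \<open>A (r k)\<close>, which carries the \<open>g\<close>-mass \<open>2^(k-1)\<close>. Where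
  \<open>2^k < \<phi> y \<le> 2^(k+1)\<close>, the value \<open>\<phi> y\<close> is at most four times the mass of \<open>S k\<close>, and
  \<open>A y\<close> is strictly larger than \<open>A (r k)\<close>. Hence the left-hand side is bounded by a sum over
  \<open>k\<close> of products to which the hypothesis \<open>local\<close> applies; the shells are disjoint, so the
  resulting integrals of \<open>\<alpha>\<close> add up to at most the full integral.

  Only the inclusions between the sets \<open>A y\<close> matter, so that the intervals \<open>(0, 1/y)\<close> and
  \<open>(1/y, \<infinity>)\<close>, which move in opposite directions, are instances of the same lemma. The strict
  inclusion in the hypotheses turns into open intervals for \<open>y\<close>. The hypothesis \<open>level\<close>
  replaces the intermediate value theorem.\<close>
lemma hardy_chain:
  fixes M :: "'a measure" and N :: "'b measure"
    and g \<alpha> :: "'a \<Rightarrow> ennreal" and U :: "'b \<Rightarrow> ennreal"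
    and \<phi> :: "'b \<Rightarrow> real" and A :: "'b \<Rightarrow> 'a set" and q t :: real and c :: ennreal
  assumes [measurable]: "g \<in> borel_measurable M" "\<alpha> \<in> borel_measurable M" "U \<in> borel_measurable N"
    and A: "\<And>y. y \<in> space N \<Longrightarrow> A y \<in> sets M"
    and D: "\<And>r. r \<in> space N \<Longrightarrow> {y \<in> space N. A r \<subset> A y} \<in> sets N"
    and chain: "\<And>y z. y \<in> space N \<Longrightarrow> z \<in> space N \<Longrightarrow> A y \<subseteq> A z \<or> A z \<subseteq> A y"
    and \<phi>: "\<And>y. y \<in> space N \<Longrightarrow> (\<integral>\<^sup>+x\<in>A y. g x \<partial>M) = ennreal (\<phi> y)"
      "\<And>y. y \<in> space N \<Longrightarrow> 0 \<le> \<phi> y"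
    and level: "\<And>y \<tau>. y \<in> space N \<Longrightarrow> 0 < \<tau> \<Longrightarrow> \<tau> < \<phi> y \<Longrightarrow> \<exists>r\<in>space N. \<phi> r = \<tau>"
    and local: "\<And>r S. r \<in> space N \<Longrightarrow> S \<in> sets M \<Longrightarrow> S \<subseteq> A r \<Longrightarrow>
      epowr (\<integral>\<^sup>+x\<in>S. g x \<partial>M) q * (\<integral>\<^sup>+y\<in>{y \<in> space N. A r \<subset> A y}. U y \<partial>N)
        \<le> c * epowr (\<integral>\<^sup>+x\<in>S. \<alpha> x \<partial>M) t"
    and q: "0 < q" and t: "1 \<le> t"
  shows "(\<integral>\<^sup>+y. U y * ennreal (\<phi> y powr q) \<partial>N)
    \<le> ennreal (4 powr q) * c * epowr (\<integral>\<^sup>+x. \<alpha> x \<partial>M) t"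
proof -
  let ?T = "\<lambda>k::int. \<exists>y\<in>space N. 2 powr real_of_int k < \<phi> y"
  \<comment> \<open>The indices \<open>k\<close> for which \<open>\<phi>\<close> exceeds \<open>2^k\<close> somewhere are closed downwards, and \<open>r k\<close>
    is meaningful only for them. One function \<open>r\<close> serves all \<open>k\<close>, so that consecutive shells share a boundary.\<close>
  define r where "r k = (SOME z. z \<in> space N \<and> \<phi> z = 2 powr real_of_int k)" for k :: int
  have r: "r k \<in> space N \<and> \<phi> (r k) = 2 powr real_of_int k" if T: "?T k" for k
  proof -
    obtain y where "y \<in> space N" "2 powr real_of_int k < \<phi> y" using T by blast
    then have "\<exists>z. z \<in> space N \<and> \<phi> z = 2 powr real_of_int k"
      using level[of y "2 powr real_of_int k"] by auto
    then show ?thesis unfolding r_def by (rule someI_ex)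
  qed
  have T_down: "?T j" if k: "?T k" and "j \<le> k" for j k
  proof -
    have "2 powr real_of_int j \<le> 2 powr real_of_int k" using \<open>j \<le> k\<close> by simp
    then show ?thesis using k order_le_less_trans by blast
  qed
  have \<phi>_mono: "\<phi> y \<le> \<phi> z" if "y \<in> space N" "z \<in> space N" "A y \<subseteq> A z" for y z
  proof -
    have "(\<integral>\<^sup>+x\<in>A y. g x \<partial>M) \<le> (\<integral>\<^sup>+x\<in>A z. g x \<partial>M)"
      using that by (intro nn_integral_mono) (auto simp: indicator_def)
    then show ?thesis using \<phi> that by (simp add: ennreal_le_iff)
  qed
  have strict: "A y \<subset> A z" if "y \<in> space N" "z \<in> space N" "\<phi> y < \<phi> z" for y z
    using chain[of y z] \<phi>_mono[of z y] that by force
  define S where "S k = (if ?T k then A (r k) - A (r (k - 1)) else {})" for k :: int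
  have S_meas [measurable]: "S k \<in> sets M" for k
    using A r T_down[of k "k - 1"] by (auto simp: S_def)
  have S_sub: "S k \<subseteq> A (r k)" for k by (auto simp: S_def)
  have S_int: "(\<integral>\<^sup>+x\<in>S k. g x \<partial>M) = ennreal (2 powr (real_of_int k - 1))" if T: "?T k" for k
  proof -
    have rk: "r k \<in> space N" "\<phi> (r k) = 2 powr real_of_int k"
      and rk': "r (k-1) \<in> space N" "\<phi> (r (k-1)) = 2 powr (real_of_int k - 1)"
      using r[OF T] r[OF T_down[OF T, of "k - 1"]] by auto
    have sub: "A (r (k - 1)) \<subset> A (r k)" using rk rk' by (intro strict) auto
    have Am [measurable]: "A (r (k - 1)) \<in> sets M" using A rk' by auto
    have "(\<integral>\<^sup>+x\<in>A (r k). g x \<partial>M)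
        = (\<integral>\<^sup>+x. g x * indicator (S k) x + g x * indicator (A (r (k - 1))) x \<partial>M)"
      using sub T by (intro nn_integral_cong) (auto simp: S_def indicator_def)
    also have "\<dots> = (\<integral>\<^sup>+x\<in>S k. g x \<partial>M) + (\<integral>\<^sup>+x\<in>A (r (k - 1)). g x \<partial>M)"
      by (rule nn_integral_add) auto
    finally have eq: "ennreal (2 powr real_of_int k)
        = (\<integral>\<^sup>+x\<in>S k. g x \<partial>M) + ennreal (2 powr (real_of_int k - 1))"
      using \<phi> rk rk' by simp
    have "2 powr real_of_int k = 2 powr (real_of_int k - 1) + 2 powr (real_of_int k - 1)"
      by (simp add: powr_diff)
    with eq have "ennreal (2 powr (real_of_int k - 1)) + ennreal (2 powr (real_of_int k - 1))
        = (\<integral>\<^sup>+x\<in>S k. g x \<partial>M) + ennreal (2 powr (real_of_int k - 1))"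
      by (simp flip: ennreal_plus)
    then show ?thesis
      using ennreal_add_left_cancel[of "ennreal (2 powr (real_of_int k - 1))"] by (simp add: add.commute)
  qed
  have S_disj: "S j \<inter> S k = {}" if "j < k" for j k
  proof (cases "?T k")
    case T: True
    have "A (r j) \<subseteq> A (r (k - 1))"
    proof (cases "j = k - 1")
      case False
      have "?T j" "?T (k - 1)" using T_down[OF T, of j] T_down[OF T, of "k - 1"] that by simp_all
      then have rj: "r j \<in> space N" "r (k - 1) \<in> space N"
        and "\<phi> (r j) = 2 powr real_of_int j" "\<phi> (r (k - 1)) = 2 powr real_of_int (k - 1)"
        using r by blast+
      then have "\<phi> (r j) < \<phi> (r (k - 1))" using False that by simp
      then show ?thesis using strict[OF rj] by blast
    qed simp
    then show ?thesis using T S_sub[of j] by (auto simp: S_def)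
  qed (simp add: S_def)
  define D' where "D' k = {y \<in> space N. A (r k) \<subset> A y}" for k
  define G where "G k y = (if ?T k then ennreal (4 powr q) *
      (epowr (\<integral>\<^sup>+x\<in>S k. g x \<partial>M) q * (U y * indicator (D' k) y)) else 0)" for k y
  have G_meas: "G k \<in> borel_measurable N" for k
  proof (cases "?T k")
    case True
    have [measurable]: "D' k \<in> sets N" using D r[OF True] by (simp add: D'_def)
    show ?thesis unfolding G_def using True by simp
  next
    case False
    then show ?thesis unfolding G_def by simp
  qed
  have point: "U y * ennreal (\<phi> y powr q) \<le> (\<Sum>n. G (int_decode n) y)" if y: "y \<in> space N" for y
  proof (cases "\<phi> y = 0")
    case False
    then have "0 < \<phi> y" using \<phi>(2)[OF y] by simp
    then obtain k where k: "2 powr real_of_int k < \<phi> y" "\<phi> y \<le> 2 powr (real_of_int k + 1)"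
      by (rule dyadic_level)
    then have T: "?T k" using y by blast
    have yD: "y \<in> D' k" using k(1) r[OF T] y strict[of "r k" y] by (simp add: D'_def)
    have "\<phi> y powr q \<le> (4 * 2 powr (real_of_int k - 1)) powr q"
      using k \<phi>(2)[OF y] q by (intro powr_mono2) (auto simp: powr_diff powr_add)
    also have "\<dots> = 4 powr q * (2 powr (real_of_int k - 1)) powr q" by (simp add: powr_mult)
    finally have "U y * ennreal (\<phi> y powr q)
        \<le> U y * (ennreal (4 powr q) * ennreal ((2 powr (real_of_int k - 1)) powr q))"
      by (intro mult_left_mono) (auto simp: ennreal_leI simp flip: ennreal_mult)
    also have "\<dots> = G k y"
      using T yD q by (simp add: G_def S_int[OF T] epowr_ennreal mult_ac)
    also have "\<dots> \<le> (\<Sum>n. G (int_decode n) y)"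
      using sum_le_suminf[of "\<lambda>n. G (int_decode n) y" "{int_encode k}"] by (simp add: summableI)
    finally show ?thesis .
  qed simp
  have G_int: "(\<integral>\<^sup>+y. G k y \<partial>N) \<le> ennreal (4 powr q) * c * epowr (\<integral>\<^sup>+x\<in>S k. \<alpha> x \<partial>M) t" for k
  proof (cases "?T k")
    case T: True
    have [measurable]: "D' k \<in> sets N" using D r[OF T] by (simp add: D'_def)
    have "(\<integral>\<^sup>+y. G k y \<partial>N) = ennreal (4 powr q) *
        (epowr (\<integral>\<^sup>+x\<in>S k. g x \<partial>M) q * (\<integral>\<^sup>+y\<in>D' k. U y \<partial>N))"
      using T by (simp add: G_def nn_integral_cmult)
    also have "\<dots> \<le> ennreal (4 powr q) * (c * epowr (\<integral>\<^sup>+x\<in>S k. \<alpha> x \<partial>M) t)"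
      using r[OF T] S_sub local[of "r k" "S k"] by (intro mult_left_mono) (auto simp: D'_def)
    finally show ?thesis by (simp add: mult_ac)
  qed (simp add: G_def)
  have disj: "disjoint_family (\<lambda>n. S (int_decode n))"
    unfolding disjoint_family_on_def
    using S_disj by (metis int_decode_eq inf_commute linorder_neqE_linordered_idom)
  have "(\<integral>\<^sup>+y. U y * ennreal (\<phi> y powr q) \<partial>N) \<le> (\<integral>\<^sup>+y. (\<Sum>n. G (int_decode n) y) \<partial>N)"
    using point by (rule nn_integral_mono)
  also have "\<dots> = (\<Sum>n. \<integral>\<^sup>+y. G (int_decode n) y \<partial>N)"
    by (rule nn_integral_suminf) (rule G_meas)
  also have "\<dots> \<le> (\<Sum>n. ennreal (4 powr q) * c * epowr (\<integral>\<^sup>+x\<in>S (int_decode n). \<alpha> x \<partial>M) t)"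
    by (intro suminf_le summableI G_int)
  also have "\<dots> = ennreal (4 powr q) * c * (\<Sum>n. epowr (\<integral>\<^sup>+x\<in>S (int_decode n). \<alpha> x \<partial>M) t)"
    by simp
  also have "\<dots> \<le> ennreal (4 powr q) * c * epowr (\<Sum>n. \<integral>\<^sup>+x\<in>S (int_decode n). \<alpha> x \<partial>M) t"
    by (intro mult_left_mono suminf_epowr_le t) auto
  also have "(\<Sum>n. \<integral>\<^sup>+x\<in>S (int_decode n). \<alpha> x \<partial>M)
      = (\<integral>\<^sup>+x. (\<Sum>n. \<alpha> x * indicator (S (int_decode n)) x) \<partial>M)"
    by (rule nn_integral_suminf[symmetric]) auto
  also have "\<dots> = (\<integral>\<^sup>+x. \<alpha> x * indicator (\<Union>n. S (int_decode n)) x \<partial>M)"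
    using disj by (simp add: suminf_indicator)
  also have "ennreal (4 powr q) * c * epowr \<dots> t \<le> ennreal (4 powr q) * c * epowr (\<integral>\<^sup>+x. \<alpha> x \<partial>M) t"
    using t by (intro mult_left_mono epowr_mono nn_integral_mono) (auto simp: indicator_def)
  finally show ?thesis .
qed

text \<open>Hoelder's inequality turns a product of two integrals bounded by \<open>C\<close> into the hypothesis
  \<open>local\<close> of the chain lemma. The conventions \<open>0 \<cdot> \<infinity> = 0\<close> and \<open>\<beta> = \<infinity>\<close> where the weight
  vanishes need a case distinction: if \<open>W \<noteq> 0\<close>, then \<open>\<beta>\<close> has a finite integral over \<open>B\<close>, so the
  weight vanishes only on a null subset of \<open>B\<close>; if \<open>W = 0\<close>, the left-hand side is \<open>0\<close>.\<close>
lemma muckenhoupt_local: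
  fixes g \<alpha> :: "'a \<Rightarrow> real" and \<beta> :: "'a \<Rightarrow> ennreal" and W C :: ennreal
  assumes [measurable]: "g \<in> borel_measurable M" "\<alpha> \<in> borel_measurable M" "\<beta> \<in> borel_measurable M"
    "S \<in> sets M"
    and \<alpha>: "\<And>x. x \<in> space M \<Longrightarrow> 0 \<le> \<alpha> x"
    and g_le: "\<And>x. x \<in> space M \<Longrightarrow> \<beta> x \<noteq> \<infinity> \<Longrightarrow>
      g x \<le> \<alpha> x powr (1 / p) * enn2real (\<beta> x) powr (1 / p')"
    and p: "1 < p" "1 / p + 1 / p' = 1" and q: "0 < q"
    and S: "S \<subseteq> B" and C: "C \<noteq> \<infinity>"
    and W: "epowr W (1 / q) * epowr (\<integral>\<^sup>+x\<in>B. \<beta> x \<partial>M) (1 / p') \<le> C"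
  shows "epowr (\<integral>\<^sup>+x\<in>S. ennreal (g x) \<partial>M) q * W
    \<le> epowr C q * epowr (\<integral>\<^sup>+x\<in>S. ennreal (\<alpha> x) \<partial>M) (q / p)"
proof (cases "W = 0")
  case False
  let ?I = "\<lambda>h. \<integral>\<^sup>+x\<in>S. h x \<partial>M"
  have p': "1 / p' = 1 - 1 / p" using p(2) by simp
  with p(1) have p'_pos: "0 < 1 / p'" by simp
  have "?I \<beta> \<le> (\<integral>\<^sup>+x\<in>B. \<beta> x \<partial>M)"
    using S by (intro nn_integral_mono) (auto simp: indicator_def)
  then have I\<beta>: "epowr W (1 / q) * epowr (?I \<beta>) (1 / p') \<le> C"
    using W p'_pos by (meson epowr_mono mult_left_mono order_trans less_imp_le zero_le)
  \<comment> \<open>A nonzero factor times \<open>\<infinity>\<close> would exceed \<open>C\<close>.\<close>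
  have "epowr (?I \<beta>) (1 / p') \<noteq> \<infinity>"
    using I\<beta> C False q by (auto simp: epowr_eq_0_iff ennreal_mult_top top_unique)
  then have fin: "?I \<beta> \<noteq> \<infinity>" using p'_pos by auto
  have "AE x in M. \<beta> x * indicator S x \<noteq> \<infinity>"
    using fin by (intro nn_integral_noteq_infinite) auto
  then have "AE x in M. ennreal (g x) * indicator S x \<le>
      ennreal ((\<alpha> x * indicator S x) powr (1 / p) * (enn2real (\<beta> x) * indicator S x) powr (1 - 1 / p))"
    using AE_space
  proof eventually_elim
    case (elim x)
    then show ?case using g_le[of x] p' by (auto simp: indicator_def intro!: ennreal_leI)
  qed
  then have "?I (\<lambda>x. ennreal (g x)) \<le> (\<integral>\<^sup>+x. ennreal ((\<alpha> x * indicator S x) powr (1 / p)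
      * (enn2real (\<beta> x) * indicator S x) powr (1 - 1 / p)) \<partial>M)"
    by (rule nn_integral_mono_AE)
  also have "\<dots> \<le> epowr (\<integral>\<^sup>+x. ennreal (\<alpha> x * indicator S x) \<partial>M) (1 / p)
      * epowr (\<integral>\<^sup>+x. ennreal (enn2real (\<beta> x) * indicator S x) \<partial>M) (1 - 1 / p)"
    using p \<alpha> by (intro Holder_nn_integral) auto
  also have "\<dots> \<le> epowr (?I (\<lambda>x. ennreal (\<alpha> x))) (1 / p) * epowr (?I \<beta>) (1 / p')"
    unfolding p' using p
    by (intro mult_mono epowr_mono nn_integral_mono)
      (auto simp: indicator_def ennreal_enn2real_if)
  finally have "epowr (?I (\<lambda>x. ennreal (g x))) q * W
      \<le> epowr (epowr (?I (\<lambda>x. ennreal (\<alpha> x))) (1 / p) * epowr (?I \<beta>) (1 / p')) q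
          * epowr (epowr W (1 / q)) q"
    using q by (simp add: epowr_epowr) (intro mult_right_mono epowr_mono, auto)
  also have "epowr (epowr (?I (\<lambda>x. ennreal (\<alpha> x))) (1 / p) * epowr (?I \<beta>) (1 / p')) q
        * epowr (epowr W (1 / q)) q
      = epowr (epowr W (1 / q) * epowr (?I \<beta>) (1 / p')) q * epowr (?I (\<lambda>x. ennreal (\<alpha> x))) (q / p)"
    using p p'_pos q by (simp add: epowr_mult epowr_epowr mult_ac)
  also have "\<dots> \<le> epowr C q * epowr (?I (\<lambda>x. ennreal (\<alpha> x))) (q / p)"
    using I\<beta> q by (intro mult_right_mono epowr_mono) auto
  finally show ?thesis .
qed simp

text \<open>For a weight \<open>V\<close>, the functions \<open>\<alpha> = V g^p\<close> and \<open>\<beta> = V^(1-p')\<close> satisfy the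
  hypothesis on \<open>g\<close> with equality wherever \<open>V\<close> is positive and finite, and \<open>weights\<close> is
  then the classical Muckenhoupt condition.\<close>
lemma hardy_muckenhoupt:
  fixes M :: "'a measure" and N :: "'b measure"
    and g \<alpha> :: "'a \<Rightarrow> real" and \<beta> :: "'a \<Rightarrow> ennreal" and U :: "'b \<Rightarrow> ennreal"
    and \<phi> :: "'b \<Rightarrow> real" and A :: "'b \<Rightarrow> 'a set" and C :: ennreal
  assumes [measurable]: "g \<in> borel_measurable M" "\<alpha> \<in> borel_measurable M" "\<beta> \<in> borel_measurable M"
      "U \<in> borel_measurable N"
    and \<alpha>: "\<And>x. x \<in> space M \<Longrightarrow> 0 \<le> \<alpha> x"
    and g_le: "\<And>x. x \<in> space M \<Longrightarrow> \<beta> x \<noteq> \<infinity> \<Longrightarrow>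
      g x \<le> \<alpha> x powr (1 / p) * enn2real (\<beta> x) powr (1 / p')"
    and A: "\<And>y. y \<in> space N \<Longrightarrow> A y \<in> sets M"
    and D: "\<And>r. r \<in> space N \<Longrightarrow> {y \<in> space N. A r \<subset> A y} \<in> sets N"
    and chain: "\<And>y z. y \<in> space N \<Longrightarrow> z \<in> space N \<Longrightarrow> A y \<subseteq> A z \<or> A z \<subseteq> A y"
    and \<phi>: "\<And>y. y \<in> space N \<Longrightarrow> (\<integral>\<^sup>+x\<in>A y. ennreal (g x) \<partial>M) = ennreal (\<phi> y)"
      "\<And>y. y \<in> space N \<Longrightarrow> 0 \<le> \<phi> y"
    and level: "\<And>y \<tau>. y \<in> space N \<Longrightarrow> 0 < \<tau> \<Longrightarrow> \<tau> < \<phi> y \<Longrightarrow> \<exists>r\<in>space N. \<phi> r = \<tau>"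
    and p: "1 < p" "1 / p + 1 / p' = 1" "p \<le> q" and C: "C \<noteq> \<infinity>"
    and weights: "\<And>r. r \<in> space N \<Longrightarrow>
      epowr (\<integral>\<^sup>+y\<in>{y \<in> space N. A r \<subset> A y}. U y \<partial>N) (1 / q)
        * epowr (\<integral>\<^sup>+x\<in>A r. \<beta> x \<partial>M) (1 / p') \<le> C"
  shows "(\<integral>\<^sup>+y. U y * ennreal (\<phi> y powr q) \<partial>N)
    \<le> ennreal (4 powr q) * epowr C q * epowr (\<integral>\<^sup>+x. ennreal (\<alpha> x) \<partial>M) (q / p)"
proof (rule hardy_chain[where g = "\<lambda>x. ennreal (g x)" and A = A])
  fix r S assume "r \<in> space N" "S \<in> sets M" "S \<subseteq> A r"
  then show "epowr (\<integral>\<^sup>+x\<in>S. ennreal (g x) \<partial>M) q * (\<integral>\<^sup>+y\<in>{y \<in> space N. A r \<subset> A y}. U y \<partial>N)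
      \<le> epowr C q * epowr (\<integral>\<^sup>+x\<in>S. ennreal (\<alpha> x) \<partial>M) (q / p)"
    using p C weights \<alpha> g_le by (intro muckenhoupt_local[where B = "A r" and \<beta> = \<beta> and p' = p']) auto
qed (use assms in auto)

section \<open>Intermediate values of integrals over intervals\<close>

lemma mono_on_measurable_lebesgue_on:
  fixes f :: "real \<Rightarrow> real"
  assumes "mono_on A f"
  shows "f \<in> borel_measurable (lebesgue_on A)"
proof (rule borel_measurable_subalgebra[OF _ _ borel_measurable_mono_on_fnc[OF assms]])
  show "sets (restrict_space borel A) \<subseteq> sets (lebesgue_on A)"
    by (auto simp: sets_restrict_space)
qed (simp add: space_restrict_space)

lemma AE_lebesgue_singleton: "AE x in lebesgue. x \<noteq> (c::real)"
  by (rule AE_completion) (rule AE_lborel_singleton)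

lemma AE_halfline_singleton: "AE x in lebesgue_on {0<..}. x \<noteq> (c::real)"
  using AE_lebesgue_singleton[of c] by (subst AE_restrict_space_iff) (auto elim: eventually_mono)

lemma integral_indicator_tendsto:
  fixes h :: "real \<Rightarrow> real"
  assumes h: "integrable lebesgue h"
    and J: "\<And>n. J n \<in> sets lebesgue" "J' \<in> sets lebesgue"
    and ev: "AE x in lebesgue. \<forall>\<^sub>F n in sequentially. x \<in> J n \<longleftrightarrow> x \<in> J'"
  shows "(\<lambda>n. LINT x|lebesgue. h x * indicator (J n) x) \<longlonglongrightarrow> (LINT x|lebesgue. h x * indicator J' x)"
proof (rule integral_dominated_convergence[where w = "\<lambda>x. norm (h x)"])
  note [measurable] = borel_measurable_integrable[OF h] J
  show "(\<lambda>x. h x * indicator J' x) \<in> borel_measurable lebesgue"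
    "\<And>n. (\<lambda>x. h x * indicator (J n) x) \<in> borel_measurable lebesgue" by measurable
  show "integrable lebesgue (\<lambda>x. norm (h x))" using h by simp
  show "AE x in lebesgue. (\<lambda>n. h x * indicator (J n) x) \<longlonglongrightarrow> h x * indicator J' x"
    using ev
  proof eventually_elim
    case (elim x)
    then have "\<forall>\<^sub>F n in sequentially. h x * indicator (J n) x = h x * indicator J' x"
      by eventually_elim (auto simp: indicator_def)
    then show ?case by (rule tendsto_eventually)
  qed
qed (auto simp: indicator_def)

lemma integral_lessThan_level:
  fixes h :: "real \<Rightarrow> real"
  assumes h: "integrable lebesgue h" and \<tau>: "0 < \<tau>" "\<tau> < (LINT x|lebesgue. h x)"
  obtains r where "(LINT x|lebesgue. h x * indicator {..<r} x) = \<tau>"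
proof -
  let ?F = "\<lambda>r. LINT x|lebesgue. h x * indicator {..<r} x"
  have cont: "continuous_on UNIV ?F"
    unfolding continuous_on_sequentially
  proof (intro allI ballI impI, elim conjE)
    fix X :: "nat \<Rightarrow> real" and a assume X: "X \<longlonglongrightarrow> a"
    show "(?F \<circ> X) \<longlonglongrightarrow> ?F a"
      unfolding comp_def
    proof (rule integral_indicator_tendsto[OF h])
      show "AE x in lebesgue. \<forall>\<^sub>F n in sequentially. x \<in> {..<X n} \<longleftrightarrow> x \<in> {..<a}"
        using AE_lebesgue_singleton[of a]
      proof eventually_elim
        case (elim x)
        then consider "x < a" | "a < x" by linarith
        then show ?case
        proof cases
          case 1
          then show ?thesis using order_tendstoD(1)[OF X] by (auto elim: eventually_mono)
        next
          case 2
          then show ?thesis using order_tendstoD(2)[OF X 2] by (auto elim: eventually_mono)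
        qed
      qed
    qed auto
  qed
  have "(\<lambda>n. ?F (- real n)) \<longlonglongrightarrow> (LINT x|lebesgue. h x * indicator {} x)"
  proof (rule integral_indicator_tendsto[OF h])
    have "\<forall>\<^sub>F n in sequentially. - real n \<le> x" for x
      using eventually_ge_at_top[of "nat \<lceil>- x\<rceil>"] by eventually_elim linarith
    then show "AE x in lebesgue. \<forall>\<^sub>F n in sequentially. x \<in> {..<- real n} \<longleftrightarrow> x \<in> {}"
      by (auto intro!: AE_I2 simp: not_less)
  qed auto
  then have "\<forall>\<^sub>F n in sequentially. ?F (- real n) < \<tau>"
    using \<tau> by (intro order_tendstoD(2)) auto
  moreover have "(\<lambda>n. ?F (real n)) \<longlonglongrightarrow> (LINT x|lebesgue. h x * indicator UNIV x)"
  proof (rule integral_indicator_tendsto[OF h])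
    have "\<forall>\<^sub>F n in sequentially. x < real n" for x
      using eventually_gt_at_top[of "nat \<lceil>x\<rceil>"] by eventually_elim linarith
    then show "AE x in lebesgue. \<forall>\<^sub>F n in sequentially. x \<in> {..<real n} \<longleftrightarrow> x \<in> UNIV"
      by (auto intro!: AE_I2)
  qed auto
  then have "\<forall>\<^sub>F n in sequentially. \<tau> < ?F (real n)"
    using \<tau> by (intro order_tendstoD(1)) auto
  ultimately have "\<forall>\<^sub>F n in sequentially. ?F (- real n) < \<tau> \<and> \<tau> < ?F (real n)"
    by (rule eventually_conj)
  then obtain n where n: "?F (- real n) < \<tau>" "\<tau> < ?F (real n)"
    using eventually_happens[of _ sequentially] by auto
  have "\<exists>r. - real n \<le> r \<and> r \<le> real n \<and> ?F r = \<tau>"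
    using n by (intro IVT' continuous_on_subset[OF cont]) auto
  then show ?thesis using that by blast
qed

lemma nn_integral_halfline:
  "(\<integral>\<^sup>+x. f x \<partial>lebesgue_on {0<..}) = (\<integral>\<^sup>+x\<in>{0<..}. f x \<partial>(lebesgue :: real measure))"
  by (rule nn_integral_restrict_space) simp

lemma nn_integral_halfline_subset:
  assumes "A \<subseteq> {0<..}"
  shows "(\<integral>\<^sup>+x\<in>A. f x \<partial>lebesgue_on {0<..}) = (\<integral>\<^sup>+x\<in>A. f x \<partial>(lebesgue :: real measure))"
  unfolding nn_integral_halfline using assms by (intro nn_integral_cong) (auto simp: indicator_def)

text \<open>Both one-sided families of intervals are handled at once: \<open>r\<close> cuts \<open>A\<close> into a left part of
  mass \<open>\<tau>\<close> and a right part of mass \<open>b - \<tau>\<close>. The mass of the left part is continuous in \<open>r\<close>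
  because points are null sets, and it runs from \<open>0\<close> to \<open>b\<close>.\<close>
lemma level_split:
  fixes g :: "real \<Rightarrow> real"
  assumes g [measurable]: "g \<in> borel_measurable (lebesgue_on {0<..})"
    and nonneg: "\<And>x. 0 < x \<Longrightarrow> 0 \<le> g x"
    and A: "A \<subseteq> {0<..}" "A \<in> sets lebesgue"
    and \<phi>: "(\<integral>\<^sup>+x\<in>A. ennreal (g x) \<partial>lebesgue_on {0<..}) = ennreal b"
    and \<tau>: "0 < \<tau>" "\<tau> < b"
  obtains r where "(\<integral>\<^sup>+x\<in>A \<inter> {..<r}. ennreal (g x) \<partial>lebesgue_on {0<..}) = ennreal \<tau>"
    "(\<integral>\<^sup>+x\<in>A \<inter> {r<..}. ennreal (g x) \<partial>lebesgue_on {0<..}) = ennreal (b - \<tau>)"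
proof -
  \<comment> \<open>Restricting \<open>g\<close> to \<open>A\<close> makes it integrable on the whole line.\<close>
  define h where "h x = (if x \<in> A then g x else 0)" for x
  have h0: "0 \<le> h x" for x using nonneg A by (auto simp: h_def)
  have "g \<in> borel_measurable (lebesgue_on A)"
    using measurable_restrict_mono[OF g A(1)] .
  then have hm [measurable]: "h \<in> borel_measurable lebesgue"
    unfolding h_def using A(2) by (simp add: borel_measurable_if)
  have set_eq: "(\<integral>\<^sup>+x\<in>A \<inter> J. ennreal (g x) \<partial>lebesgue_on {0<..}) = (\<integral>\<^sup>+x. ennreal (h x * indicator J x) \<partial>lebesgue)"
    for J using A by (subst nn_integral_halfline_subset) (auto simp: h_def indicator_def intro!: nn_integral_cong)
  have h_nn: "(\<integral>\<^sup>+x. ennreal (h x) \<partial>lebesgue) = ennreal b"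
    using set_eq[of UNIV] \<phi> by simp
  then have hi: "integrable lebesgue h"
    using h0 by (intro integrableI_nonneg) auto
  have hb: "(LINT x|lebesgue. h x) = b"
    using h_nn h0 \<tau> hi by (subst (asm) nn_integral_eq_integral) (auto simp: integral_nonneg_AE)
  obtain r where r: "(LINT x|lebesgue. h x * indicator {..<r} x) = \<tau>"
    using integral_lessThan_level[OF hi \<tau>(1)] \<tau>(2) hb by blast
  have int: "integrable lebesgue (\<lambda>x. h x * indicator J x)" if "J \<in> sets lebesgue" for J
    using hi that by (rule integrable_real_mult_indicator[rotated])
  have "(LINT x|lebesgue. h x) = (LINT x|lebesgue. h x * indicator {..<r} x + h x * indicator {r<..} x)"
  proof (rule integral_cong_AE)
    show "(\<lambda>x. h x * indicator {..<r} x + h x * indicator {r<..} x) \<in> borel_measurable lebesgue"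
      by (intro borel_measurable_add borel_measurable_integrable int) auto
    show "AE x in lebesgue. h x = h x * indicator {..<r} x + h x * indicator {r<..} x"
      using AE_lebesgue_singleton[of r] by eventually_elim (auto simp: indicator_def)
  qed simp
  also have "\<dots> = \<tau> + (LINT x|lebesgue. h x * indicator {r<..} x)"
    using int r by (subst Bochner_Integration.integral_add) auto
  finally have r': "(LINT x|lebesgue. h x * indicator {r<..} x) = b - \<tau>" using hb by simp
  show ?thesis
  proof
    show "(\<integral>\<^sup>+x\<in>A \<inter> {..<r}. ennreal (g x) \<partial>lebesgue_on {0<..}) = ennreal \<tau>"
      unfolding set_eq r[symmetric] using h0 by (intro nn_integral_eq_integral int) auto
    show "(\<integral>\<^sup>+x\<in>A \<inter> {r<..}. ennreal (g x) \<partial>lebesgue_on {0<..}) = ennreal (b - \<tau>)"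
      unfolding set_eq r'[symmetric] using h0 by (intro nn_integral_eq_integral int) auto
  qed
qed

lemma level_initial:
  fixes g :: "real \<Rightarrow> real"
  assumes g: "g \<in> borel_measurable (lebesgue_on {0<..})"
    and nonneg: "\<And>x. 0 < x \<Longrightarrow> 0 \<le> g x"
    and \<phi>: "(\<integral>\<^sup>+x\<in>{0<..<c}. ennreal (g x) \<partial>lebesgue_on {0<..}) = ennreal b"
    and \<tau>: "0 < \<tau>" "\<tau> < b"
  shows "\<exists>r>0. (\<integral>\<^sup>+x\<in>{0<..<r}. ennreal (g x) \<partial>lebesgue_on {0<..}) = ennreal \<tau>"
proof -
  obtain r where r: "(\<integral>\<^sup>+x\<in>{0<..<c} \<inter> {..<r}. ennreal (g x) \<partial>lebesgue_on {0<..}) = ennreal \<tau>"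
    by (rule level_split[OF g nonneg _ _ \<phi> \<tau>]) auto
  have "{0<..<c} \<inter> {..<r} = {0<..<min c r}" by auto
  moreover from this have "0 < min c r"
    using r \<tau> by (cases "0 < min c r") (auto simp: greaterThanLessThan_empty)
  ultimately show ?thesis using r by auto
qed

lemma level_tail:
  fixes g :: "real \<Rightarrow> real"
  assumes g: "g \<in> borel_measurable (lebesgue_on {0<..})"
    and nonneg: "\<And>x. 0 < x \<Longrightarrow> 0 \<le> g x"
    and c: "0 < c"
    and \<phi>: "(\<integral>\<^sup>+x\<in>{c<..}. ennreal (g x) \<partial>lebesgue_on {0<..}) = ennreal b"
    and \<tau>: "0 < \<tau>" "\<tau> < b"
  shows "\<exists>r>0. (\<integral>\<^sup>+x\<in>{r<..}. ennreal (g x) \<partial>lebesgue_on {0<..}) = ennreal \<tau>"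
proof -
  \<comment> \<open>Cut off the mass \<open>b - \<tau>\<close> on the left to retain \<open>\<tau>\<close> on the right.\<close>
  have "0 < b - \<tau>" "b - \<tau> < b" using \<tau> by auto
  then obtain r where r: "(\<integral>\<^sup>+x\<in>{c<..} \<inter> {r<..}. ennreal (g x) \<partial>lebesgue_on {0<..}) = ennreal (b - (b - \<tau>))"
    using level_split[OF g nonneg _ _ \<phi>, of "b - \<tau>"] c by auto
  have "{c<..} \<inter> {r<..} = {max c r<..}" by auto
  then show ?thesis using r c by (intro exI[of _ "max c r"]) auto
qed

section \<open>Hardy inequalities for initial segments and tails\<close>

lemma halfline_sets:
  fixes a b :: real
  shows "{0<..<b} \<in> sets (lebesgue_on {0<..})" "0 \<le> a \<Longrightarrow> {a<..} \<in> sets (lebesgue_on {0<..})"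
  by (auto simp: sets_restrict_space_iff)

lemma hardy_initial:
  fixes g \<alpha> :: "real \<Rightarrow> real" and \<beta> U :: "real \<Rightarrow> ennreal" and C :: ennreal
  defines "L \<equiv> lebesgue_on {0<..}"
  defines "\<phi> \<equiv> \<lambda>y. \<integral>\<^sup>+x\<in>{0<..<1/y}. ennreal (g x) \<partial>L"
  assumes meas: "g \<in> borel_measurable L" "\<alpha> \<in> borel_measurable L" "\<beta> \<in> borel_measurable L"
      "U \<in> borel_measurable L"
    and nonneg: "\<And>x. 0 < x \<Longrightarrow> 0 \<le> g x" "\<And>x. 0 < x \<Longrightarrow> 0 \<le> \<alpha> x"
    and fin: "\<And>y. 0 < y \<Longrightarrow> \<phi> y < \<infinity>"
    and g_le: "\<And>x. 0 < x \<Longrightarrow> \<beta> x \<noteq> \<infinity> \<Longrightarrow>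
      g x \<le> \<alpha> x powr (1 / p) * enn2real (\<beta> x) powr (1 / p')"
    and p: "1 < p" "1 / p + 1 / p' = 1" "p \<le> q" and C: "C \<noteq> \<infinity>"
    and weights: "\<And>r. 0 < r \<Longrightarrow>
      epowr (\<integral>\<^sup>+y\<in>{0<..<1/r}. U y \<partial>L) (1 / q) * epowr (\<integral>\<^sup>+x\<in>{0<..<r}. \<beta> x \<partial>L) (1 / p') \<le> C"
  shows "(\<integral>\<^sup>+y. U y * ennreal (enn2real (\<phi> y) powr q) \<partial>L)
    \<le> ennreal (4 powr q) * epowr C q * epowr (\<integral>\<^sup>+x. ennreal (\<alpha> x) \<partial>L) (q / p)"
proof -
  have sp: "space L = {0<..}" by (simp add: L_def space_restrict_space)
  have \<phi>: "(\<integral>\<^sup>+x\<in>{0<..<1/y}. ennreal (g x) \<partial>L) = ennreal (enn2real (\<phi> y))" if "0 < y" for y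
    using fin[OF that] by (simp add: \<phi>_def)
  have D: "{y \<in> space L. {0<..<1/r} \<subset> {0<..<1/y}} = {0<..<r}" if "0 < r" for r
  proof -
    have eq: "{0<..<1/r} \<subset> {0<..<1/y} \<longleftrightarrow> y < r" if "0 < y" for y
    proof -
      have "{0<..<1/r} \<subset> {0<..<1/y} \<longleftrightarrow> 1/r < 1/y"
        using \<open>0 < r\<close> that
        by (auto simp: psubset_eq greaterThanLessThan_subseteq_greaterThanLessThan)
      then show ?thesis using \<open>0 < r\<close> that by (simp add: field_simps)
    qed
    have "y \<in> {y \<in> space L. {0<..<1/r} \<subset> {0<..<1/y}} \<longleftrightarrow> y \<in> {0<..<r}" for y
      unfolding sp mem_Collect_eq greaterThan_iff greaterThanLessThan_iff using eq[of y] by blast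
    then show ?thesis by (rule set_eqI)
  qed
  note S = halfline_sets(1)[folded L_def]
  show ?thesis
  proof (rule hardy_muckenhoupt[where A = "\<lambda>y. {0<..<1/y}" and g = g and \<alpha> = \<alpha> and \<beta> = \<beta> and p' = p'])
    fix y \<tau> assume y: "y \<in> space L" and \<tau>: "0 < \<tau>" "\<tau> < enn2real (\<phi> y)"
    obtain r where r: "r > 0" "(\<integral>\<^sup>+x\<in>{0<..<r}. ennreal (g x) \<partial>L) = ennreal \<tau>"
      using level_initial[OF _ _ \<phi>[unfolded L_def] \<tau>] meas nonneg y sp unfolding L_def by auto
    then show "\<exists>r\<in>space L. enn2real (\<phi> r) = \<tau>"
      using \<tau> by (intro bexI[of _ "1 / r"]) (auto simp: \<phi>_def sp)
  next
    fix r assume "r \<in> space L"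
    then show "epowr (\<integral>\<^sup>+y\<in>{y \<in> space L. {0<..<1/r} \<subset> {0<..<1/y}}. U y \<partial>L) (1 / q)
        * epowr (\<integral>\<^sup>+x\<in>{0<..<1/r}. \<beta> x \<partial>L) (1 / p') \<le> C"
      using weights[of "1 / r"] D[of r] by (simp add: sp)
  next
    fix y z :: real
    show "{0<..<1/y} \<subseteq> {0<..<1/z} \<or> {0<..<1/z} \<subseteq> {0<..<1/y}"
      using linear[of "1/y" "1/z"] by (auto intro: less_le_trans)
  next
    fix r assume "r \<in> space L"
    then show "{y \<in> space L. {0<..<1/r} \<subset> {0<..<1/y}} \<in> sets L"
      using D[of r] S by (simp add: sp)
  qed (use meas nonneg g_le p C S \<phi> sp in auto)
qed

lemma hardy_tail:
  fixes g \<alpha> :: "real \<Rightarrow> real" and \<beta> U :: "real \<Rightarrow> ennreal" and C :: ennreal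
  defines "L \<equiv> lebesgue_on {0<..}"
  defines "\<phi> \<equiv> \<lambda>y. \<integral>\<^sup>+x\<in>{1/y<..}. ennreal (g x) \<partial>L"
  assumes meas: "g \<in> borel_measurable L" "\<alpha> \<in> borel_measurable L" "\<beta> \<in> borel_measurable L"
      "U \<in> borel_measurable L"
    and nonneg: "\<And>x. 0 < x \<Longrightarrow> 0 \<le> g x" "\<And>x. 0 < x \<Longrightarrow> 0 \<le> \<alpha> x"
    and fin: "\<And>y. 0 < y \<Longrightarrow> \<phi> y < \<infinity>"
    and g_le: "\<And>x. 0 < x \<Longrightarrow> \<beta> x \<noteq> \<infinity> \<Longrightarrow>
      g x \<le> \<alpha> x powr (1 / p) * enn2real (\<beta> x) powr (1 / p')"
    and p: "1 < p" "1 / p + 1 / p' = 1" "p \<le> q" and C: "C \<noteq> \<infinity>"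
    and weights: "\<And>r. 0 < r \<Longrightarrow>
      epowr (\<integral>\<^sup>+y\<in>{1/r<..}. U y \<partial>L) (1 / q) * epowr (\<integral>\<^sup>+x\<in>{r<..}. \<beta> x \<partial>L) (1 / p') \<le> C"
  shows "(\<integral>\<^sup>+y. U y * ennreal (enn2real (\<phi> y) powr q) \<partial>L)
    \<le> ennreal (4 powr q) * epowr C q * epowr (\<integral>\<^sup>+x. ennreal (\<alpha> x) \<partial>L) (q / p)"
proof -
  have sp: "space L = {0<..}" by (simp add: L_def space_restrict_space)
  have \<phi>: "(\<integral>\<^sup>+x\<in>{1/y<..}. ennreal (g x) \<partial>L) = ennreal (enn2real (\<phi> y))" if "0 < y" for y
    using fin[OF that] by (simp add: \<phi>_def)
  have D: "{y \<in> space L. {1/r<..} \<subset> {1/y<..}} = {r<..}" if "0 < r" for r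
  proof -
    have eq: "{1/r<..} \<subset> {1/y<..} \<longleftrightarrow> r < y" if "0 < y" for y
    proof -
      have "{1/r<..} \<subset> {1/y<..} \<longleftrightarrow> 1/y < 1/r" unfolding psubset_eq less_le by auto
      then show ?thesis using \<open>0 < r\<close> that by (simp add: field_simps)
    qed
    have "y \<in> {y \<in> space L. {1/r<..} \<subset> {1/y<..}} \<longleftrightarrow> y \<in> {r<..}" for y
      unfolding sp mem_Collect_eq greaterThan_iff using eq[of y] \<open>0 < r\<close> less_trans[of 0 r y] by metis
    then show ?thesis by (rule set_eqI)
  qed
  note S = halfline_sets(2)[folded L_def]
  show ?thesis
  proof (rule hardy_muckenhoupt[where A = "\<lambda>y. {1/y<..}" and g = g and \<alpha> = \<alpha> and \<beta> = \<beta> and p' = p'])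
    fix y \<tau> assume y: "y \<in> space L" and \<tau>: "0 < \<tau>" "\<tau> < enn2real (\<phi> y)"
    obtain r where r: "r > 0" "(\<integral>\<^sup>+x\<in>{r<..}. ennreal (g x) \<partial>L) = ennreal \<tau>"
      using level_tail[OF _ _ _ \<phi>[unfolded L_def] \<tau>] meas nonneg y sp unfolding L_def by auto
    then show "\<exists>r\<in>space L. enn2real (\<phi> r) = \<tau>"
      using \<tau> by (intro bexI[of _ "1 / r"]) (auto simp: \<phi>_def sp)
  next
    fix r assume "r \<in> space L"
    then show "epowr (\<integral>\<^sup>+y\<in>{y \<in> space L. {1/r<..} \<subset> {1/y<..}}. U y \<partial>L) (1 / q)
        * epowr (\<integral>\<^sup>+x\<in>{1/r<..}. \<beta> x \<partial>L) (1 / p') \<le> C"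
      using weights[of "1 / r"] D[of r] by (simp add: sp)
  next
    fix y z :: real
    show "{1/y<..} \<subseteq> {1/z<..} \<or> {1/z<..} \<subseteq> {1/y<..}"
      using linear[of "1/y" "1/z"] by auto
  next
    fix r assume "r \<in> space L"
    then show "{y \<in> space L. {1/r<..} \<subset> {1/y<..}} \<in> sets L"
      using D[of r] S by (simp add: sp)
  qed (use meas nonneg g_le p C S \<phi> sp in auto)
qed

section \<open>The transform\<close>

lemma recip_exponent_dual:
  assumes "1 \<le> a"
  shows "recip_exponent a + recip_exponent (dual_exponent a) = 1"
proof (cases a)
  case (real r)
  then have r: "1 \<le> r" using assms by simp
  show ?thesis
  proof (cases "r = 1")
    case True
    then show ?thesis using real by (simp add: recip_exponent_def dual_exponent_def)
  next
    case False
    then have "1 < r" using r by simp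
    have "ennreal r - 1 = ennreal (r - 1)" using ennreal_minus[of 1 r] by simp
    then have "dual_exponent a = ennreal (r / (r - 1))"
      using real \<open>1 < r\<close> by (simp add: dual_exponent_def divide_ennreal)
    then show ?thesis
      using real \<open>1 < r\<close> by (simp add: recip_exponent_def divide_ennreal field_simps flip: ennreal_1)
  qed
next
  case top
  then show ?thesis by (simp add: recip_exponent_def dual_exponent_def)
qed

lemma powr_add_le:
  fixes a b q :: real
  assumes "0 \<le> a" "0 \<le> b" "0 < q"
  shows "(a + b) powr q \<le> 2 powr q * (a powr q + b powr q)"
proof -
  have "(a + b) powr q \<le> (2 * max a b) powr q"
    using assms by (intro powr_mono2) auto
  also have "\<dots> = 2 powr q * max a b powr q" using assms by (simp add: powr_mult)
  also have "\<dots> \<le> 2 powr q * (a powr q + b powr q)"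
    by (intro mult_left_mono) (auto simp: max_def)
  finally show ?thesis .
qed

text \<open>Admissibility splits the half-line at \<open>1\<close>; monotonicity of \<open>s\<close> allows it to be split at any
  other point \<open>r\<close>: between \<open>1\<close> and \<open>r\<close> the integrands \<open>s |f|\<close> and \<open>s^(1/2) |f|\<close> differ by
  the factor \<open>s^(1/2)\<close>, which \<open>s r\<close> bounds from the side that is needed.\<close>
lemma admissible_integrals_finite:
  fixes s :: "real \<Rightarrow> real" and f :: "real \<Rightarrow> complex"
  assumes s_pos: "\<And>x. x > 0 \<Longrightarrow> s x > 0" and s_mono: "mono_on {0<..} s"
    and f: "admissible s f" and r: "0 < r"
  shows "(\<integral>\<^sup>+x\<in>{0<..<r}. ennreal (s x * norm (f x)) \<partial>lebesgue_on {0<..}) < \<infinity>" (is "?near < _")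
    and "(\<integral>\<^sup>+x\<in>{r<..}. ennreal (s x powr (1/2) * norm (f x)) \<partial>lebesgue_on {0<..}) < \<infinity>" (is "?far < _")
proof -
  let ?L = "lebesgue_on {0<..} :: real measure"
  let ?g = "\<lambda>x. ennreal (s x * norm (f x)) * indicator {0<..<1} x"
  let ?h = "\<lambda>x. ennreal (s x powr (1/2) * norm (f x)) * indicator {1<..} x"
  have [measurable]: "f \<in> borel_measurable ?L" using f by (simp add: admissible_def)
  have [measurable]: "s \<in> borel_measurable ?L" by (rule mono_on_measurable_lebesgue_on) fact
  have "{1<..} \<subseteq> {(0::real)<..}" "{0<..<1} \<subseteq> {(0::real)<..}" by auto
  then have fin: "(\<integral>\<^sup>+x. ?g x \<partial>?L) < \<infinity>" "(\<integral>\<^sup>+x. ?h x \<partial>?L) < \<infinity>"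
    using f by (auto simp: admissible_def nn_integral_halfline_subset less_top)
  note [measurable] = halfline_sets
  have meas: "?g \<in> borel_measurable ?L" "?h \<in> borel_measurable ?L" by measurable
  have comb: "(\<integral>\<^sup>+x. c * ?g x + d * ?h x \<partial>?L) < \<infinity>" if "c < \<infinity>" "d < \<infinity>" for c d
    using fin meas that by (simp add: nn_integral_add nn_integral_cmult ennreal_mult_less_top)
  have "?near \<le> (\<integral>\<^sup>+x. 1 * ?g x + ennreal (s r powr (1/2)) * ?h x \<partial>?L)"
  proof (rule nn_integral_mono_AE)
    show "AE x in ?L. ennreal (s x * norm (f x)) * indicator {0<..<r} x
        \<le> 1 * ?g x + ennreal (s r powr (1/2)) * ?h x"
      using AE_halfline_singleton[of 1] AE_space
    proof eventually_elim
      case (elim x)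
      then have x: "0 < x" "x \<noteq> 1" by (auto simp: space_restrict_space)
      show ?case
      proof (cases "1 < x \<and> x < r")
        case True
        then have "s x \<le> s r" using x r by (intro mono_onD[OF s_mono]) auto
        then have "s x * norm (f x) \<le> s r powr (1/2) * (s x powr (1/2) * norm (f x))"
          using s_pos[OF x(1)]
          by (simp add: powr_half_sqrt real_le_rsqrt mult_right_mono flip: mult.assoc real_sqrt_mult)
            (intro mult_right_mono real_le_rsqrt, simp_all add: power2_eq_square mult_right_mono)
        then show ?thesis using True by (simp add: ennreal_leI flip: ennreal_mult)
      qed (use x in \<open>auto simp: indicator_def\<close>)
    qed
  qed
  also have "\<dots> < \<infinity>" by (rule comb) auto
  finally show "?near < \<infinity>" .
  have "?far \<le> (\<integral>\<^sup>+x. ennreal (s r powr (-1/2)) * ?g x + 1 * ?h x \<partial>?L)"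
  proof (rule nn_integral_mono_AE)
    show "AE x in ?L. ennreal (s x powr (1/2) * norm (f x)) * indicator {r<..} x
        \<le> ennreal (s r powr (-1/2)) * ?g x + 1 * ?h x"
      using AE_halfline_singleton[of 1] AE_space
    proof eventually_elim
      case (elim x)
      then have x: "0 < x" "x \<noteq> 1" by (auto simp: space_restrict_space)
      show ?case
      proof (cases "r < x \<and> x < 1")
        case True
        then have le: "s r \<le> s x" using x r by (intro mono_onD[OF s_mono]) auto
        have "1 = s r powr (-1/2) * s r powr (1/2)"
          using s_pos[OF r] by (simp flip: powr_add)
        also have "\<dots> \<le> s r powr (-1/2) * s x powr (1/2)"
          using le s_pos[OF r] by (intro mult_left_mono powr_mono2) auto
        finally have "1 * (s x powr (1/2) * norm (f x))
            \<le> s r powr (-1/2) * s x powr (1/2) * (s x powr (1/2) * norm (f x))"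
          by (rule mult_right_mono) simp
        also have "\<dots> = s r powr (-1/2) * (s x powr (1/2 + 1/2) * norm (f x))"
          unfolding powr_add by simp
        finally have "s x powr (1/2) * norm (f x) \<le> s r powr (-1/2) * (s x * norm (f x))"
          using s_pos[OF x(1)] by simp
        then show ?thesis using True x s_pos[OF x(1)] by (simp add: ennreal_leI flip: ennreal_mult)
      qed (use x in \<open>auto simp: indicator_def\<close>)
    qed
  qed
  also have "\<dots> < \<infinity>" by (rule comb) auto
  finally show "?far < \<infinity>" .
qed

text \<open>The kernel bound is used as \<open>|K| \<le> B\<close> for \<open>x < 1/y\<close> and as \<open>|K| \<le> B (s x w y)^(-1/2)\<close>
  for \<open>x > 1/y\<close>. Where the integrand is not integrable, the Bochner integral is \<open>0\<close> and the
  bound is trivial.\<close>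
lemma F_transform_bound:
  fixes s w :: "real \<Rightarrow> real" and K :: "real \<Rightarrow> real \<Rightarrow> complex" and f :: "real \<Rightarrow> complex"
  assumes s_pos: "\<And>x. x > 0 \<Longrightarrow> s x > 0" and w_pos: "w y > 0"
    and [measurable]: "s \<in> borel_measurable (lebesgue_on {0<..})" "f \<in> borel_measurable (lebesgue_on {0<..})"
    and B: "0 < B" "\<And>x. x > 0 \<Longrightarrow> norm (K x y) \<le> B * min 1 ((s x * w y) powr (-1/2))"
    and y: "0 < y"
  shows "ennreal (norm (F_transform s K f y)) \<le> ennreal B *
    ((\<integral>\<^sup>+x\<in>{0<..<1/y}. ennreal (s x * norm (f x)) \<partial>lebesgue_on {0<..})
     + ennreal (w y powr (-1/2)) * (\<integral>\<^sup>+x\<in>{1/y<..}. ennreal (s x powr (1/2) * norm (f x)) \<partial>lebesgue_on {0<..}))"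
proof -
  let ?L = "lebesgue_on {0<..} :: real measure"
  let ?k = "\<lambda>x. complex_of_real (s x) * f x * K x y"
  let ?g = "\<lambda>x. ennreal (s x * norm (f x)) * indicator {0<..<1/y} x"
  let ?h = "\<lambda>x. ennreal (s x powr (1/2) * norm (f x)) * indicator {1/y<..} x"
  have "ennreal (norm (F_transform s K f y)) \<le> (\<integral>\<^sup>+x. ennreal (norm (indicator {0<..} x *\<^sub>R ?k x)) \<partial>lebesgue)"
  proof (cases "set_integrable lebesgue {0<..} ?k")
    case True
    then show ?thesis
      unfolding F_transform_def set_integrable_def set_lebesgue_integral_def
      by (rule integral_norm_bound_ennreal)
  next
    case False
    then show ?thesis
      by (simp add: F_transform_def set_integrable_def set_lebesgue_integral_def not_integrable_integral_eq)
  qed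
  also have "\<dots> = (\<integral>\<^sup>+x. ennreal (norm (?k x)) \<partial>?L)"
    unfolding nn_integral_halfline by (intro nn_integral_cong) (auto simp: indicator_def)
  also have "\<dots> \<le> (\<integral>\<^sup>+x. ennreal B * (?g x + ennreal (w y powr (-1/2)) * ?h x) \<partial>?L)"
  proof (rule nn_integral_mono_AE)
    show "AE x in ?L. ennreal (norm (?k x)) \<le> ennreal B * (?g x + ennreal (w y powr (-1/2)) * ?h x)"
      using AE_halfline_singleton[of "1/y"] AE_space
    proof eventually_elim
      case (elim x)
      then have x: "0 < x" "x \<noteq> 1/y" by (auto simp: space_restrict_space)
      note sx = s_pos[OF x(1)]
      have k: "norm (?k x) \<le> s x * norm (f x) * (B * min 1 ((s x * w y) powr (-1/2)))"
        using B(2)[OF x(1)] sx by (simp add: norm_mult mult_left_mono)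
      show ?case
      proof (cases "x < 1/y")
        case True
        have "s x * norm (f x) * (B * min 1 ((s x * w y) powr (-1/2))) \<le> s x * norm (f x) * (B * 1)"
          using B sx by (intro mult_left_mono) auto
        then have "norm (?k x) \<le> B * (s x * norm (f x))" using k by (simp add: mult_ac)
        then show ?thesis using True x B sx by (simp add: ennreal_leI flip: ennreal_mult)
      next
        case False
        have "s x powr 1 * s x powr (-1/2) = s x powr (1/2)"
          by (simp only: powr_add[symmetric]) simp
        then have eq: "s x * s x powr (-1/2) = s x powr (1/2)" using sx by simp
        have "s x * norm (f x) * (B * min 1 ((s x * w y) powr (-1/2)))
            \<le> s x * norm (f x) * (B * (s x * w y) powr (-1/2))"
          using B sx by (intro mult_left_mono) auto
        also have "\<dots> = B * (w y powr (-1/2) * ((s x * s x powr (-1/2)) * norm (f x)))"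
          using sx w_pos by (simp add: powr_mult)
        finally have "norm (?k x) \<le> B * (w y powr (-1/2) * (s x powr (1/2) * norm (f x)))"
          using k unfolding eq by linarith
        then show ?thesis using False x B sx by (simp add: ennreal_leI flip: ennreal_mult)
      qed
    qed
  qed
  also have "\<dots> = ennreal B * ((\<integral>\<^sup>+x. ?g x \<partial>?L) + ennreal (w y powr (-1/2)) * (\<integral>\<^sup>+x. ?h x \<partial>?L))"
  proof -
    have [measurable]: "{0<..<1/y} \<in> sets ?L" "{1/y<..} \<in> sets ?L"
      using halfline_sets y by auto
    have "?g \<in> borel_measurable ?L" "?h \<in> borel_measurable ?L" by measurable
    then show ?thesis by (simp add: nn_integral_cmult nn_integral_add)
  qed
  finally show ?thesis .
qed

text \<open>The exponents of the two weights fit together: with \<open>\<alpha> = v (s^d n)^p\<close> and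
  \<open>\<beta> = v^(1-p') s^(p' (\<rho> - \<theta>))\<close>, the powers of \<open>v\<close> cancel in \<open>\<alpha>^(1/p) \<beta>^(1/p')\<close> since
  \<open>(1 - p') / p' = - 1 / p\<close>, and \<open>d + \<rho> = 1\<close> leaves \<open>s^(1-\<theta>) n\<close>. Here \<open>n\<close> stands for
  \<open>|f x|\<close>; \<open>\<theta> = 0\<close> is the choice near the origin and \<open>\<theta> = 1/2\<close> the one near infinity.
  Finiteness of \<open>\<beta>\<close> excludes \<open>v = 0\<close>.\<close>
lemma holder_factorisation:
  fixes s v n p p' d \<theta> \<rho> :: real
  assumes "0 < s" "0 \<le> v" "0 \<le> n" and p: "1 < p" "p' = p / (p - 1)" and \<rho>: "d + \<rho> = 1"
    and fin: "epowr (ennreal v) (1 - p') * ennreal (s powr (p' * (\<rho> - \<theta>))) \<noteq> \<infinity>"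
  shows "s powr (1 - \<theta>) * n \<le> (v * (s powr d * n) powr p) powr (1 / p)
    * enn2real (epowr (ennreal v) (1 - p') * ennreal (s powr (p' * (\<rho> - \<theta>)))) powr (1 / p')"
proof -
  have p': "1 < p'" unfolding p(2) using p(1) by (simp add: less_divide_eq)
  have "v \<noteq> 0"
    using fin p' \<open>0 < s\<close> by (auto simp: epowr_def ennreal_top_mult ennreal_eq_0_iff)
  then have v: "0 < v" using \<open>0 \<le> v\<close> by simp
  have "epowr (ennreal v) (1 - p') = ennreal (v powr (1 - p'))"
    using v p' by (simp add: epowr_def ennreal_eq_0_iff)
  then have "enn2real (epowr (ennreal v) (1 - p') * ennreal (s powr (p' * (\<rho> - \<theta>)))) powr (1 / p')
      = v powr ((1 - p') / p') * s powr (\<rho> - \<theta>)"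
    using p' by (simp add: powr_mult powr_powr flip: ennreal_mult)
  moreover have "(v * (s powr d * n) powr p) powr (1 / p) = v powr (1 / p) * (s powr d * n)"
    using p assms by (simp add: powr_mult powr_powr)
  moreover have "(1 - p') / p' = - (1 / p)" unfolding p(2) using p(1) by (simp add: field_simps)
  moreover have "v powr (1 / p) * v powr (- (1 / p)) = 1"
    using v by (simp flip: powr_add)
  moreover have "s powr d * s powr (\<rho> - \<theta>) = s powr (1 - \<theta>)"
    using \<rho> by (simp flip: powr_add add: algebra_simps)
  ultimately show ?thesis
    by (simp add: mult_ac)
qed

theorem theorem1p1:
  fixes s w u v :: "real \<Rightarrow> real"
    and K :: "real \<Rightarrow> real \<Rightarrow> complex"
    and p p' q :: real
    and a a' :: ennreal
  assumes s_pos: "\<And>x. x > 0 \<Longrightarrow> s x > 0"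
    and w_pos: "\<And>y. y > 0 \<Longrightarrow> w y > 0"
    and s_mono: "mono_on {0<..} s"
    and w_mono: "mono_on {0<..} w"
    and s_loc_int: "\<And>R. R > 0 \<Longrightarrow> set_integrable lebesgue {0<..R} s"
    and K_cont: "continuous_on ({0<..} \<times> {0<..}) (\<lambda>(x, y). K x y)"
    and K_bound: "\<exists>B>0. \<forall>x>0. \<forall>y>0. norm (K x y) \<le> B * min 1 ((s x * w y) powr (-1/2))"
    and p_gt_1: "1 < p"
    and p_le_q: "p \<le> q"
    and p'_eq: "p' = p / (p - 1)"
    and a_ge_1: "1 \<le> a"
    and a'_eq: "a' = dual_exponent a"
    and u_meas: "u \<in> borel_measurable (lebesgue_on {0<..})"
    and u_nonneg: "\<And>y. y > 0 \<Longrightarrow> u y \<ge> 0"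
    and v_meas: "v \<in> borel_measurable (lebesgue_on {0<..})"
    and v_nonneg: "\<And>x. x > 0 \<Longrightarrow> v x \<ge> 0"
    and weights: "\<exists>C::real. C > 0 \<and>
      (SUP r\<in>{0<..}.
         epowr (\<integral>\<^sup>+ y\<in>{0<..<1/r}.
           ennreal (u y * w y powr (q * recip_exponent a')) \<partial>lebesgue) (1 / q)
         * epowr (\<integral>\<^sup>+ x\<in>{0<..<r}.
           epowr (ennreal (v x)) (1 - p') * ennreal (s x powr (p' * recip_exponent a')) \<partial>lebesgue)
             (1 / p')) \<le> ennreal C \<and>
      (SUP r\<in>{0<..}.
         epowr (\<integral>\<^sup>+ y\<in>{1/r<..}.
           ennreal (u y * w y powr (q * (recip_exponent a' - 1/2))) \<partial>lebesgue) (1 / q)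
         * epowr (\<integral>\<^sup>+ x\<in>{r<..}.
           epowr (ennreal (v x)) (1 - p') * ennreal (s x powr (p' * (recip_exponent a' - 1/2))) \<partial>lebesgue)
             (1 / p')) \<le> ennreal C"
  shows "\<exists>c::real. c > 0 \<and> (\<forall>f. admissible s f \<longrightarrow>
    weighted_norm q u (\<lambda>y. complex_of_real (w y powr recip_exponent a') * F_transform s K f y)
      \<le> ennreal c * weighted_norm p v (\<lambda>x. complex_of_real (s x powr recip_exponent a) * f x))"
proof -
  let ?L = "lebesgue_on {0<..} :: real measure"
  define \<rho> where "\<rho> = recip_exponent a'"
  define d where "d = recip_exponent a"
  have d: "d + \<rho> = 1" using recip_exponent_dual[OF a_ge_1] by (simp add: d_def \<rho>_def a'_eq)
  have pq: "0 < p" "0 < q" using p_gt_1 p_le_q by auto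
  have pp': "1 / p + 1 / p' = 1" and p'_gt: "1 < p'"
    unfolding p'_eq using p_gt_1 by (simp_all add: field_simps)
  obtain B where B: "0 < B" "\<And>x y. 0 < x \<Longrightarrow> 0 < y \<Longrightarrow> norm (K x y) \<le> B * min 1 ((s x * w y) powr (-1/2))"
    using K_bound by blast
  define U where "U \<theta> y = ennreal (u y * w y powr (q * (\<rho> - \<theta>)))" for \<theta> y
  define \<beta> where "\<beta> \<theta> x = epowr (ennreal (v x)) (1 - p') * ennreal (s x powr (p' * (\<rho> - \<theta>)))" for \<theta> x
  obtain C where C: "0 < C"
    and near: "\<And>r. 0 < r \<Longrightarrow> epowr (\<integral>\<^sup>+y\<in>{0<..<1/r}. U 0 y \<partial>lebesgue) (1 / q)
        * epowr (\<integral>\<^sup>+x\<in>{0<..<r}. \<beta> 0 x \<partial>lebesgue) (1 / p') \<le> ennreal C"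
    and far: "\<And>r. 0 < r \<Longrightarrow> epowr (\<integral>\<^sup>+y\<in>{1/r<..}. U (1/2) y \<partial>lebesgue) (1 / q)
        * epowr (\<integral>\<^sup>+x\<in>{r<..}. \<beta> (1/2) x \<partial>lebesgue) (1 / p') \<le> ennreal C"
    using weights unfolding U_def \<beta>_def \<rho>_def SUP_le_iff by auto
  have [measurable]: "s \<in> borel_measurable ?L" "w \<in> borel_measurable ?L"
    using s_mono w_mono by (auto intro: mono_on_measurable_lebesgue_on)
  note [measurable] = u_meas v_meas
  have U_meas: "U \<theta> \<in> borel_measurable ?L" for \<theta> unfolding U_def by measurable
  have "(\<lambda>x. epowr (ennreal (v x)) (1 - p')) \<in> borel_measurable ?L"
  proof (subst measurable_cong)
    show "epowr (ennreal (v x)) (1 - p') = (if v x = 0 then \<infinity> else ennreal (v x powr (1 - p')))"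
      if "x \<in> space ?L" for x
      using that v_nonneg[of x] p'_gt by (auto simp: epowr_def space_restrict_space ennreal_eq_0_iff)
  qed measurable
  then have \<beta>_meas: "\<beta> \<theta> \<in> borel_measurable ?L" for \<theta> unfolding \<beta>_def by measurable
  \<comment> \<open>The factor \<open>4 powr q * C powr q\<close> is the Hardy constant; it is doubled because there are two
    Hardy terms, and \<open>(2 * B) powr q\<close> comes from splitting the transform into two parts.\<close>
  define c where "c = ((2 * B) powr q * (2 * (4 powr q * C powr q))) powr (1 / q)"
  have c: "0 < c" using B C by (simp add: c_def)
  have "weighted_norm q u (\<lambda>y. complex_of_real (w y powr \<rho>) * F_transform s K f y)
      \<le> ennreal c * weighted_norm p v (\<lambda>x. complex_of_real (s x powr d) * f x)"
    if f: "admissible s f" for f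
  proof -
    have [measurable]: "f \<in> borel_measurable ?L" using f by (simp add: admissible_def)
    define \<alpha> where "\<alpha> x = v x * norm (complex_of_real (s x powr d) * f x) powr p" for x
    define G where "G y = (\<integral>\<^sup>+x\<in>{0<..<1/y}. ennreal (s x * norm (f x)) \<partial>?L)" for y
    define H where "H y = (\<integral>\<^sup>+x\<in>{1/y<..}. ennreal (s x powr (1/2) * norm (f x)) \<partial>?L)" for y
    let ?X = "\<integral>\<^sup>+x. ennreal (\<alpha> x) \<partial>?L"
    have \<alpha>_meas [measurable]: "\<alpha> \<in> borel_measurable ?L" unfolding \<alpha>_def by measurable
    have \<alpha>_nonneg: "0 \<le> \<alpha> x" if "0 < x" for x using v_nonneg[OF that] by (simp add: \<alpha>_def)
    have GH: "G y < \<infinity>" "H y < \<infinity>" if "0 < y" for y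
      using admissible_integrals_finite[OF s_pos s_mono f, of "1/y"] that by (auto simp: G_def H_def)
    have fact: "s x powr (1 - \<theta>) * norm (f x) \<le> \<alpha> x powr (1 / p) * enn2real (\<beta> \<theta> x) powr (1 / p')"
      if "0 < x" "\<beta> \<theta> x \<noteq> \<infinity>" for x \<theta>
      using holder_factorisation[of "s x" "v x" "norm (f x)" p p' d \<rho> \<theta>] that s_pos v_nonneg
        p_gt_1 p'_eq d by (simp add: \<alpha>_def \<beta>_def norm_mult)
    have G_hardy: "(\<integral>\<^sup>+y. U 0 y * ennreal (enn2real (G y) powr q) \<partial>?L)
        \<le> ennreal (4 powr q) * epowr (ennreal C) q * epowr ?X (q / p)"
      unfolding G_def
    proof (rule hardy_initial[where \<beta> = "\<beta> 0" and p' = p'])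
      fix r :: real assume "0 < r"
      then show "epowr (\<integral>\<^sup>+y\<in>{0<..<1/r}. U 0 y \<partial>?L) (1 / q)
          * epowr (\<integral>\<^sup>+x\<in>{0<..<r}. \<beta> 0 x \<partial>?L) (1 / p') \<le> ennreal C"
        using near by (subst (1 2) nn_integral_halfline_subset) auto
    next
      fix x :: real assume "0 < x" "\<beta> 0 x \<noteq> \<infinity>"
      then show "s x * norm (f x) \<le> \<alpha> x powr (1 / p) * enn2real (\<beta> 0 x) powr (1 / p')"
        using fact[of x 0] s_pos[of x] by simp
    qed (use s_pos GH(1) \<alpha>_nonneg p_gt_1 p_le_q pp' \<beta>_meas U_meas in
        \<open>auto simp: G_def less_imp_le\<close>)
    have H_hardy: "(\<integral>\<^sup>+y. U (1/2) y * ennreal (enn2real (H y) powr q) \<partial>?L)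
        \<le> ennreal (4 powr q) * epowr (ennreal C) q * epowr ?X (q / p)"
      unfolding H_def
    proof (rule hardy_tail[where \<beta> = "\<beta> (1/2)" and p' = p'])
      fix r :: real assume r: "0 < r"
      then have "{1/r<..} \<subseteq> {(0::real)<..}" "{r<..} \<subseteq> {0<..}"
        by (auto intro: less_trans[of 0 "1/r"])
      then show "epowr (\<integral>\<^sup>+y\<in>{1/r<..}. U (1/2) y \<partial>?L) (1 / q)
          * epowr (\<integral>\<^sup>+x\<in>{r<..}. \<beta> (1/2) x \<partial>?L) (1 / p') \<le> ennreal C"
        using far[OF r] by (simp add: nn_integral_halfline_subset)
    next
      fix x :: real assume "0 < x" "\<beta> (1/2) x \<noteq> \<infinity>"
      then show "s x powr (1/2) * norm (f x) \<le> \<alpha> x powr (1 / p) * enn2real (\<beta> (1/2) x) powr (1 / p')"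
        using fact[of x "1/2"] by simp
    qed (use GH(2) \<alpha>_nonneg p_gt_1 p_le_q pp' \<beta>_meas U_meas in \<open>auto simp: H_def\<close>)
    \<comment> \<open>\<open>G\<close> and \<open>H\<close> are monotone in \<open>y\<close>, hence measurable; additivity of the integral needs this.\<close>
    have "mono_on {0<..} (\<lambda>y. - enn2real (G y))"
    proof (rule mono_onI)
      fix y z :: real assume yz: "y \<in> {0<..}" "z \<in> {0<..}" "y \<le> z"
      then have "1 / z \<le> 1 / y" by (simp add: frac_le)
      then have "G z \<le> G y"
        unfolding G_def by (intro nn_integral_mono) (auto simp: indicator_def)
      then show "- enn2real (G y) \<le> - enn2real (G z)" using GH yz by (simp add: enn2real_mono)
    qed
    from mono_on_measurable_lebesgue_on[OF this]
    have G_meas [measurable]: "(\<lambda>y. enn2real (G y)) \<in> borel_measurable ?L" by simp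
    have "mono_on {0<..} (\<lambda>y. enn2real (H y))"
    proof (rule mono_onI)
      fix y z :: real assume yz: "y \<in> {0<..}" "z \<in> {0<..}" "y \<le> z"
      then have "1 / z \<le> 1 / y" by (simp add: frac_le)
      then have "H y \<le> H z"
        unfolding H_def by (intro nn_integral_mono) (auto simp: indicator_def)
      then show "enn2real (H y) \<le> enn2real (H z)" using GH yz by (simp add: enn2real_mono)
    qed
    from mono_on_measurable_lebesgue_on[OF this]
    have H_meas [measurable]: "(\<lambda>y. enn2real (H y)) \<in> borel_measurable ?L" .
    note [measurable] = U_meas
    have point: "ennreal (u y * norm (complex_of_real (w y powr \<rho>) * F_transform s K f y) powr q)
        \<le> ennreal ((2 * B) powr q) * (U 0 y * ennreal (enn2real (G y) powr q)
            + U (1/2) y * ennreal (enn2real (H y) powr q))" if y: "0 < y" for y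
    proof -
      define G' H' where "G' = enn2real (G y)" and "H' = w y powr (-1/2) * enn2real (H y)"
      have nn: "0 \<le> G'" "0 \<le> H'" by (auto simp: G'_def H'_def)
      have "ennreal (norm (F_transform s K f y)) \<le> ennreal B * (G y + ennreal (w y powr (-1/2)) * H y)"
        unfolding G_def H_def using B y s_pos w_pos by (intro F_transform_bound) auto
      also have "G y = ennreal G'" using GH(1)[OF y] by (simp add: G'_def)
      also have "ennreal (w y powr (-1/2)) * H y = ennreal H'"
        using GH(2)[OF y] by (simp add: H'_def ennreal_mult)
      also have "ennreal B * (ennreal G' + ennreal H') = ennreal (B * (G' + H'))"
        using B nn by (simp flip: ennreal_mult ennreal_plus)
      finally have "norm (F_transform s K f y) \<le> B * (G' + H')"
        using B nn by (simp add: ennreal_le_iff)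
      then have "norm (F_transform s K f y) powr q \<le> (B * (G' + H')) powr q"
        using pq by (intro powr_mono2) auto
      also have "\<dots> = B powr q * (G' + H') powr q" using B nn by (simp add: powr_mult)
      also have "\<dots> \<le> B powr q * (2 powr q * (G' powr q + H' powr q))"
        using nn pq by (intro mult_left_mono powr_add_le) auto
      also have "\<dots> = (2 * B) powr q * (G' powr q + H' powr q)"
        using B by (simp add: powr_mult)
      finally have F: "norm (F_transform s K f y) powr q \<le> (2 * B) powr q * (G' powr q + H' powr q)" .
      have H'q: "H' powr q = w y powr (- (q / 2)) * enn2real (H y) powr q"
        by (simp add: H'_def powr_mult powr_powr)
      have wq: "w y powr (\<rho> * q) * w y powr (- (q / 2)) = w y powr (q * (\<rho> - 1/2))"
        by (simp flip: powr_add add: algebra_simps)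
      have "u y * norm (complex_of_real (w y powr \<rho>) * F_transform s K f y) powr q
          = (u y * w y powr (\<rho> * q)) * norm (F_transform s K f y) powr q"
        by (simp add: norm_mult powr_mult powr_powr)
      also have "\<dots> \<le> (u y * w y powr (\<rho> * q)) * ((2 * B) powr q * (G' powr q + H' powr q))"
        using F u_nonneg[OF y] by (intro mult_left_mono) auto
      also have "\<dots> = (2 * B) powr q * (u y * w y powr (q * (\<rho> - 0)) * G' powr q
          + u y * (w y powr (\<rho> * q) * w y powr (- (q / 2))) * enn2real (H y) powr q)"
        unfolding H'q by (simp add: algebra_simps)
      also have "\<dots> = (2 * B) powr q * (u y * w y powr (q * (\<rho> - 0)) * enn2real (G y) powr q
          + u y * w y powr (q * (\<rho> - 1/2)) * enn2real (H y) powr q)"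
        unfolding wq G'_def ..
      finally show ?thesis
        using u_nonneg[OF y] unfolding U_def
        by (simp add: ennreal_leI flip: ennreal_mult ennreal_plus)
    qed
    have "(\<integral>\<^sup>+y\<in>{0<..}. ennreal (u y * norm (complex_of_real (w y powr \<rho>) * F_transform s K f y) powr q) \<partial>lebesgue)
        \<le> (\<integral>\<^sup>+y. ennreal ((2 * B) powr q) * (U 0 y * ennreal (enn2real (G y) powr q)
            + U (1/2) y * ennreal (enn2real (H y) powr q)) \<partial>?L)"
      unfolding nn_integral_halfline[symmetric]
      by (intro nn_integral_mono point) (simp add: space_restrict_space)
    also have "\<dots> = ennreal ((2 * B) powr q) * ((\<integral>\<^sup>+y. U 0 y * ennreal (enn2real (G y) powr q) \<partial>?L)
            + (\<integral>\<^sup>+y. U (1/2) y * ennreal (enn2real (H y) powr q) \<partial>?L))"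
      by (simp add: nn_integral_cmult nn_integral_add)
    also have "\<dots> \<le> ennreal ((2 * B) powr q) *
        (ennreal (4 powr q) * epowr (ennreal C) q * epowr ?X (q / p)
          + ennreal (4 powr q) * epowr (ennreal C) q * epowr ?X (q / p))"
      by (intro mult_left_mono add_mono G_hardy H_hardy) auto
    also have "\<dots> = ennreal ((2 * B) powr q) *
        ((ennreal (4 powr q * C powr q) + ennreal (4 powr q * C powr q)) * epowr ?X (q / p))"
      using C pq by (simp add: epowr_ennreal ennreal_mult distrib_right)
    also have "\<dots> = ennreal ((2 * B) powr q * (2 * (4 powr q * C powr q))) * epowr ?X (q / p)"
    proof -
      have "ennreal z + ennreal z = ennreal (2 * z)" if "0 \<le> z" for z
        using that by (simp flip: ennreal_plus)
      then have "ennreal (4 powr q * C powr q) + ennreal (4 powr q * C powr q)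
          = ennreal (2 * (4 powr q * C powr q))" by simp
      then show ?thesis by (simp add: ennreal_mult mult.assoc)
    qed
    finally have "weighted_norm q u (\<lambda>y. complex_of_real (w y powr \<rho>) * F_transform s K f y)
        \<le> epowr (ennreal ((2 * B) powr q * (2 * (4 powr q * C powr q))) * epowr ?X (q / p)) (1 / q)"
      unfolding weighted_norm_def using pq by (intro epowr_mono) auto
    also have "\<dots> = ennreal c * epowr ?X (1 / p)"
      using pq by (simp add: epowr_mult epowr_epowr epowr_ennreal c_def)
    also have "epowr ?X (1 / p) = weighted_norm p v (\<lambda>x. complex_of_real (s x powr d) * f x)"
      by (simp add: weighted_norm_def nn_integral_halfline \<alpha>_def)
    finally show ?thesis .
  qed
  then show ?thesis using c unfolding \<rho>_def d_def by blast
qed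

end
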